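(* Let $G$ be a finite connected graph with at least one edge and $\Delta$ a decision tree for $G$. Then the set $2^{E(G)}$ of all subgraphs of $G$ is the disjoint union $$2^{E(G)}=\biguplus_{T\text{ spanning tree of }G}\{S: T\setminus\mathcal I(T)\subseteq S\subseteq T\cup\mathcal E(T)\},$$ where $\mathcal I(T)$ (resp. $\mathcal E(T)$) is the set of $\Delta$-active edges of $T$ that lie in $T$ (resp. not in $T$).
   Context: Graphs are finite, loops and multiple edges allowed; $m=|E(G)|$. Subgraphs are spanning, identified with edge sets. An isthmus is an edge whose deletion increases the number of connected components; an edge is standard if neither a loop nor an isthmus. A decision tree for $G$ is a perfect binary tree with all leaves at depth $m-1$ (root at depth $0$), each node labelled by an edge, such that along every root-to-leaf path the labels form a permutation of $E(G)$. Given a subgraph $S$: set $H:=G$, $n:=$ root of $\Delta$; for $k=1,\dots,m$ let $e_k$ be the label of $n$ and do exactly one of: (i) if $e_k$ is standard in $H$ and $e_k\notin S$: type $\mathbf S_e$, $H:=H\setminus e_k$ (deletion), $n:=$ left child; (ii) if $e_k$ is a loop of $H$: type $\mathbf L$, $H:=H\setminus e_k$, $n:=$ left child; (iii) if $e_k$ is standard in $H$ and $e_k\in S$: type $\mathbf S_i$, $H:=H/e_k$ (contraction), $n:=$ right child; (iv) if $e_k$ is an isthmus of $H$: type $\mathbf I$, $H:=H/e_k$, $n:=$ right child. An edge is $\Delta$-active for $S$ if its type is $\mathbf L$ or $\mathbf I$. *)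

theory Defs
  imports Main "HOL-Library.Tree" "HOL-Library.Disjoint_Sets"
begin

text \<open>Undirected multigraphs: each edge carries its set of endpoints, which is a singleton for a
  loop. Parallel edges are distinct edges with the same endpoint set.\<close>

record ('v, 'e) mgraph =
  verts :: "'v set"
  edges :: "'e set"
  ends :: "'e \<Rightarrow> 'v set"

definition finite_mgraph :: "('v, 'e) mgraph \<Rightarrow> bool" where
  "finite_mgraph G \<longleftrightarrow> finite (verts G) \<and> finite (edges G) \<and>
     (\<forall>e\<in>edges G. ends G e \<subseteq> verts G \<and> card (ends G e) \<in> {1, 2})"

definition adj :: "('v, 'e) mgraph \<Rightarrow> 'v rel" where
  "adj G = {(u, v). \<exists>e\<in>edges G. ends G e = {u, v}}"

definition components :: "('v, 'e) mgraph \<Rightarrow> 'v set set" where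
  "components G = verts G // ((adj G)\<^sup>* \<inter> verts G \<times> verts G)"

definition mg_connected :: "('v, 'e) mgraph \<Rightarrow> bool" where
  "mg_connected G \<longleftrightarrow> verts G \<noteq> {} \<and> (\<forall>u\<in>verts G. \<forall>v\<in>verts G. (u, v) \<in> (adj G)\<^sup>*)"

definition is_cycle :: "('v, 'e) mgraph \<Rightarrow> 'v list \<Rightarrow> 'e list \<Rightarrow> bool" where
  "is_cycle G vs es \<longleftrightarrow> es \<noteq> [] \<and> length vs = length es \<and>
     set vs \<subseteq> verts G \<and> set es \<subseteq> edges G \<and> distinct vs \<and> distinct es \<and>
     (\<forall>i<length es. ends G (es ! i) = {vs ! i, vs ! (Suc i mod length es)})"

definition is_tree :: "('v, 'e) mgraph \<Rightarrow> bool" where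
  "is_tree G \<longleftrightarrow> mg_connected G \<and> \<not> (\<exists>vs es. is_cycle G vs es)"

definition spanning_tree :: "('v, 'e) mgraph \<Rightarrow> 'e set \<Rightarrow> bool" where
  "spanning_tree G T \<longleftrightarrow> T \<subseteq> edges G \<and> is_tree (G\<lparr>edges := T\<rparr>)"

definition delete_edge :: "('v, 'e) mgraph \<Rightarrow> 'e \<Rightarrow> ('v, 'e) mgraph" where
  "delete_edge G e = G\<lparr>edges := edges G - {e}\<rparr>"

text \<open>Contraction stays inside the vertex type: the endpoints of the contracted edge are all
  replaced by one of them. The choice only affects the result up to renaming a vertex.\<close>

definition merge_ends :: "('v, 'e) mgraph \<Rightarrow> 'e \<Rightarrow> 'v \<Rightarrow> 'v" where
  "merge_ends G e v = (if v \<in> ends G e then (SOME w. w \<in> ends G e) else v)"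

definition contract_edge :: "('v, 'e) mgraph \<Rightarrow> 'e \<Rightarrow> ('v, 'e) mgraph" where
  "contract_edge G e =
     \<lparr>verts = merge_ends G e ` verts G, edges = edges G - {e},
      ends = (\<lambda>e'. merge_ends G e ` ends G e')\<rparr>"

definition is_loop :: "('v, 'e) mgraph \<Rightarrow> 'e \<Rightarrow> bool" where
  "is_loop G e \<longleftrightarrow> e \<in> edges G \<and> (\<exists>v. ends G e = {v})"

definition isthmus :: "('v, 'e) mgraph \<Rightarrow> 'e \<Rightarrow> bool" where
  "isthmus G e \<longleftrightarrow> e \<in> edges G \<and> card (components G) < card (components (delete_edge G e))"

definition standard :: "('v, 'e) mgraph \<Rightarrow> 'e \<Rightarrow> bool" where
  "standard G e \<longleftrightarrow> e \<in> edges G \<and> \<not> is_loop G e \<and> \<not> isthmus G e"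

text \<open>In \<^typ>\<open>'e tree\<close> the constructor \<^const>\<open>Leaf\<close> is the empty tree and carries no label, so a
  labelled leaf \<open>e\<close> of a decision tree is \<open>Node Leaf e Leaf\<close>. A perfect tree whose labelled leaves
  all have depth \<open>m - 1\<close> is thus a \<^const>\<open>complete\<close> tree of height \<open>m\<close>.\<close>

fun branches :: "'e tree \<Rightarrow> 'e list set" where
  "branches Leaf = {[]}"
| "branches (Node l e r) = (\<lambda>p. e # p) ` (branches l \<union> branches r)"

definition decision_tree :: "('v, 'e) mgraph \<Rightarrow> 'e tree \<Rightarrow> bool" where
  "decision_tree G \<Delta> \<longleftrightarrow> complete \<Delta> \<and> height \<Delta> = card (edges G) \<and>
     (\<forall>p\<in>branches \<Delta>. distinct p \<and> set p = edges G)"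

datatype edge_type = Standard_ext | Loop | Standard_int | Isthmus

text \<open>The edges in the order they are visited, with their types. When the second argument is a
  decision tree for the first, the visited edge always belongs to the current graph, so that the
  last branch is exactly the case of an isthmus.\<close>

fun run :: "('v, 'e) mgraph \<Rightarrow> 'e tree \<Rightarrow> 'e set \<Rightarrow> ('e \<times> edge_type) list" where
  "run H Leaf S = []"
| "run H (Node l e r) S =
     (if standard H e \<and> e \<notin> S then (e, Standard_ext) # run (delete_edge H e) l S
      else if is_loop H e then (e, Loop) # run (delete_edge H e) l S
      else if standard H e \<and> e \<in> S then (e, Standard_int) # run (contract_edge H e) r S
      else (e, Isthmus) # run (contract_edge H e) r S)"

definition active :: "('v, 'e) mgraph \<Rightarrow> 'e tree \<Rightarrow> 'e set \<Rightarrow> 'e set" where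
  "active G \<Delta> S = {e. (e, Loop) \<in> set (run G \<Delta> S) \<or> (e, Isthmus) \<in> set (run G \<Delta> S)}"

definition int_active :: "('v, 'e) mgraph \<Rightarrow> 'e tree \<Rightarrow> 'e set \<Rightarrow> 'e set" where
  "int_active G \<Delta> S = active G \<Delta> S \<inter> S"

definition ext_active :: "('v, 'e) mgraph \<Rightarrow> 'e tree \<Rightarrow> 'e set \<Rightarrow> 'e set" where
  "ext_active G \<Delta> S = active G \<Delta> S - S"

end

theory Submission imports Defs begin

text \<open>Processing the root edge \<open>e\<close> of \<open>\<Delta>\<close> splits the claim into the same claim for
  \<open>G \<setminus> e\<close> and \<open>G / e\<close>. If \<open>e\<close> is standard, it is inactive for every spanning tree, so a subgraph
  and the tree of its interval agree at \<open>e\<close>: those avoiding \<open>e\<close> live in \<open>G \<setminus> e\<close>, those containing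
  \<open>e\<close> in \<open>G / e\<close>. If \<open>e\<close> is a loop or an isthmus, membership of \<open>e\<close> is the same for all spanning
  trees, and as \<open>e\<close> is active it is irrelevant for membership in the intervals.
  The graph-theoretic input is that, for a non-loop \<open>e \<notin> A\<close>, the set \<open>A\<close> is a spanning tree of
  \<open>G / e\<close> iff \<open>A \<union> {e}\<close> is one of \<open>G\<close>; it is obtained by viewing trees as minimal connected graphs.\<close>

section \<open>Adjacency, reachability and edge deletion\<close>

lemma sym_adj: "sym (adj G)"
  unfolding adj_def sym_def by (auto simp: insert_commute)

lemma sym_adj_rtrancl: "(x, y) \<in> (adj G)\<^sup>* \<Longrightarrow> (y, x) \<in> (adj G)\<^sup>*"
  by (meson sym_adj sym_rtrancl symD)

lemma adj_mono:
  assumes "edges G \<subseteq> edges H" "ends G = ends H"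
  shows "adj G \<subseteq> adj H"
  using assms unfolding adj_def by auto

lemma adj_edges_insert:
  assumes "ends G e = {a, b}"
  shows "adj (G\<lparr>edges := insert e A\<rparr>) = adj (G\<lparr>edges := A\<rparr>) \<union> {(a, b), (b, a)}"
  using assms unfolding adj_def by (auto simp: doubleton_eq_iff)

lemma delete_edge_simps [simp]:
  "verts (delete_edge G e) = verts G" "edges (delete_edge G e) = edges G - {e}"
  "ends (delete_edge G e) = ends G"
  by (simp_all add: delete_edge_def)

lemma finite_mgraph_edges_subset:
  "finite_mgraph G \<Longrightarrow> A \<subseteq> edges G \<Longrightarrow> finite_mgraph (G\<lparr>edges := A\<rparr>)"
  unfolding finite_mgraph_def by (auto intro: finite_subset)

lemma finite_mgraph_delete_edge: "finite_mgraph G \<Longrightarrow> finite_mgraph (delete_edge G e)"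
  unfolding delete_edge_def by (rule finite_mgraph_edges_subset) auto

lemma ends_doubleton:
  assumes "finite_mgraph G" "e \<in> edges G"
  obtains a b where "ends G e = {a, b}" "a \<in> verts G" "b \<in> verts G"
proof -
  have "card (ends G e) = 1 \<or> card (ends G e) = 2" "ends G e \<subseteq> verts G"
    using assms unfolding finite_mgraph_def by auto
  then show thesis
    using that by (auto simp: card_1_singleton_iff card_2_iff)
qed

lemma mg_connected_mono:
  assumes "mg_connected G" "verts G = verts H" "edges G \<subseteq> edges H" "ends G = ends H"
  shows "mg_connected H"
  using assms rtrancl_mono[OF adj_mono[OF assms(3,4)]] unfolding mg_connected_def
  by (metis subsetD)

subsection \<open>Trees as minimal connected graphs\<close>

text \<open>Vertices are not confined to \<open>verts G\<close>, in keeping with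
  \<open>(adj G)\<^sup>*\<close>, which is reflexive on the whole vertex type;
  \<open>is_path_verts\<close> places them there once the start is.\<close>

definition is_path :: "('v, 'e) mgraph \<Rightarrow> 'v list \<Rightarrow> 'e list \<Rightarrow> bool" where
  "is_path G vs es \<longleftrightarrow> length vs = Suc (length es) \<and> distinct vs \<and> set es \<subseteq> edges G \<and>
     (\<forall>i<length es. ends G (es ! i) = {vs ! i, vs ! Suc i})"

lemma is_path_distinct_edges:
  assumes "is_path G vs es"
  shows "distinct es"
proof -
  have "i = j" if "i < length es" "j < length es" "es ! i = es ! j" for i j
  proof -
    have "{vs ! i, vs ! Suc i} = {vs ! j, vs ! Suc j}"
      using assms that unfolding is_path_def by metis
    moreover have "vs ! k = vs ! l \<longleftrightarrow> k = l" if "k \<le> length es" "l \<le> length es" for k l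
      using assms that unfolding is_path_def by (simp add: nth_eq_iff_index_eq)
    ultimately show ?thesis
      using that unfolding doubleton_eq_iff by auto
  qed
  then show ?thesis
    by (auto simp: distinct_conv_nth)
qed

lemma is_path_take:
  assumes "is_path G vs es" "i < length vs"
  shows "is_path G (take (Suc i) vs) (take i es)"
  using assms unfolding is_path_def by (auto dest: in_set_takeD)

lemma path_exists:
  assumes "(u, v) \<in> (adj G)\<^sup>*"
  shows "\<exists>vs es. is_path G vs es \<and> hd vs = u \<and> last vs = v"
  using assms
proof (induction rule: rtrancl_induct)
  case base
  show ?case by (rule exI[of _ "[u]"], rule exI[of _ "[]"]) (simp add: is_path_def)
next
  case (step y z)
  then obtain vs es where p: "is_path G vs es" "hd vs = u" "last vs = y" by blast
  obtain e where e: "e \<in> edges G" "ends G e = {y, z}"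
    using step unfolding adj_def by auto
  have ne: "vs \<noteq> []" using p unfolding is_path_def by auto
  show ?case
  \<comment> \<open>If the new end already lies on the path, the path is cut back to it; this keeps
    the vertices distinct.\<close>
  proof (cases "z \<in> set vs")
    case True
    then obtain i where i: "i < length vs" "vs ! i = z" by (auto simp: in_set_conv_nth)
    have "last (take (Suc i) vs) = z" using i by (simp add: take_Suc_conv_app_nth)
    moreover have "hd (take (Suc i) vs) = u" using p ne by simp
    ultimately show ?thesis using is_path_take[OF p(1) i(1)] by blast
  next
    case False
    have "vs ! length es = y" using p ne unfolding is_path_def by (simp add: last_conv_nth)
    then have "is_path G (vs @ [z]) (es @ [e])"
      using p(1) False e unfolding is_path_def by (auto simp: nth_append less_Suc_eq)
    then show ?thesis using p ne by (metis hd_append2 last_snoc)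
  qed
qed

lemma is_path_verts:
  assumes "finite_mgraph G" "is_path G vs es" "hd vs \<in> verts G"
  shows "set vs \<subseteq> verts G"
proof
  fix x assume "x \<in> set vs"
  then obtain i where i: "i < length vs" "x = vs ! i" by (auto simp: in_set_conv_nth)
  show "x \<in> verts G"
  proof (cases i)
    case 0
    then show ?thesis using i assms(3) by (simp add: hd_conv_nth)
  next
    case (Suc j)
    then have "j < length es" using i assms(2) unfolding is_path_def by auto
    then have "ends G (es ! j) = {vs ! j, x}" "es ! j \<in> edges G"
      using i Suc assms(2) unfolding is_path_def by auto
    then show ?thesis using assms(1) unfolding finite_mgraph_def by blast
  qed
qed

text \<open>The rest of a cycle is a detour around its last edge; conversely a path between the ends
  of \<open>e\<close> avoiding \<open>e\<close> is closed up by \<open>e\<close>. A loop is the case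
  of the one-vertex path.\<close>

lemma cycle_iff_redundant_edge:
  assumes fin: "finite_mgraph G"
  shows "(\<exists>vs es. is_cycle G vs es) \<longleftrightarrow>
    (\<exists>e\<in>edges G. \<exists>u v. ends G e = {u, v} \<and> (u, v) \<in> (adj (delete_edge G e))\<^sup>*)"
proof
  assume "\<exists>vs es. is_cycle G vs es"
  then obtain vs es where c: "is_cycle G vs es" by blast
  define n where "n = length es - 1"
  have n: "length es = Suc n" "length vs = Suc n"
    using c unfolding n_def is_cycle_def by auto
  have E: "ends G (es ! i) = {vs ! i, vs ! (Suc i mod length es)}" "es ! i \<in> edges G"
    if "i < length es" for i
    using c that unfolding is_cycle_def by auto
  have "(vs ! 0, vs ! i) \<in> (adj (delete_edge G (es ! n)))\<^sup>*" if "i \<le> n" for i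
    using that
  proof (induction i)
    case (Suc i)
    have "es ! i \<noteq> es ! n"
      using c n Suc.prems unfolding is_cycle_def by (simp add: nth_eq_iff_index_eq)
    then have "(vs ! i, vs ! Suc i) \<in> adj (delete_edge G (es ! n))"
      using E[of i] n Suc.prems unfolding adj_def by auto
    then show ?case using Suc by (simp add: rtrancl.rtrancl_into_rtrancl)
  qed simp
  moreover have "ends G (es ! n) = {vs ! 0, vs ! n}" "es ! n \<in> edges G"
    using E[of n] n by (auto simp: insert_commute)
  ultimately show "\<exists>e\<in>edges G. \<exists>u v. ends G e = {u, v} \<and> (u, v) \<in> (adj (delete_edge G e))\<^sup>*"
    by blast
next
  assume "\<exists>e\<in>edges G. \<exists>u v. ends G e = {u, v} \<and> (u, v) \<in> (adj (delete_edge G e))\<^sup>*"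
  then obtain e u v where e: "e \<in> edges G" "ends G e = {u, v}"
    "(u, v) \<in> (adj (delete_edge G e))\<^sup>*" by blast
  obtain vs es where p: "is_path (delete_edge G e) vs es" "hd vs = u" "last vs = v"
    using path_exists[OF e(3)] by blast
  have "u \<in> verts G" using fin e unfolding finite_mgraph_def by blast
  then have V: "set vs \<subseteq> verts G"
    using is_path_verts[OF finite_mgraph_delete_edge[OF fin] p(1)] p(2) by simp
  have len: "length vs = Suc (length es)" using p unfolding is_path_def by auto
  have uv: "vs ! 0 = u" "vs ! length es = v"
    using len p(2,3) hd_conv_nth[of vs] last_conv_nth[of vs] by force+
  have "ends G ((es @ [e]) ! i) = {vs ! i, vs ! (Suc i mod length (es @ [e]))}"
    if "i < length (es @ [e])" for i
  proof (cases "i < length es")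
    case True
    then show ?thesis using p(1) unfolding is_path_def by (simp add: nth_append)
  next
    case False
    then have "i = length es" using that by simp
    then show ?thesis using uv e by (simp add: insert_commute)
  qed
  then have "is_cycle G vs (es @ [e])"
    using is_path_distinct_edges[OF p(1)] p(1) V e unfolding is_cycle_def is_path_def by auto
  then show "\<exists>vs es. is_cycle G vs es" by blast
qed

text \<open>A detour between the ends of \<open>e\<close> replaces every use of \<open>e\<close> in
  a walk.\<close>

lemma mg_connected_delete_edge_iff:
  assumes "finite_mgraph G" "mg_connected G" "e \<in> edges G" "ends G e = {u, v}"
  shows "mg_connected (delete_edge G e) \<longleftrightarrow> (u, v) \<in> (adj (delete_edge G e))\<^sup>*"
proof
  assume "mg_connected (delete_edge G e)"
  then show "(u, v) \<in> (adj (delete_edge G e))\<^sup>*"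
    using assms unfolding mg_connected_def finite_mgraph_def by auto
next
  assume uv: "(u, v) \<in> (adj (delete_edge G e))\<^sup>*"
  have "adj G \<subseteq> adj (delete_edge G e) \<union> {(u, v), (v, u)}"
    using assms(4) unfolding adj_def by (auto simp: doubleton_eq_iff)
  then have "adj G \<subseteq> (adj (delete_edge G e))\<^sup>*"
    using uv sym_adj_rtrancl[OF uv] by auto
  then have "(adj G)\<^sup>* \<subseteq> (adj (delete_edge G e))\<^sup>*"
    by (metis rtrancl_idemp rtrancl_mono)
  then show "mg_connected (delete_edge G e)"
    using assms(2) unfolding mg_connected_def by auto
qed

text \<open>Connectedness passes through contraction directly, whereas cycles change length; hence
  this description of trees.\<close>

lemma is_tree_iff_minimal_connected:
  assumes "finite_mgraph G"
  shows "is_tree G \<longleftrightarrow> mg_connected G \<and> (\<forall>e\<in>edges G. \<not> mg_connected (delete_edge G e))"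
proof -
  have "(\<exists>u v. ends G e = {u, v} \<and> (u, v) \<in> (adj (delete_edge G e))\<^sup>*) \<longleftrightarrow>
      mg_connected (delete_edge G e)" if con: "mg_connected G" and e: "e \<in> edges G" for e
  proof -
    obtain a b where "ends G e = {a, b}" using ends_doubleton[OF assms e] .
    then show ?thesis using mg_connected_delete_edge_iff[OF assms con e] by blast
  qed
  then have "(\<exists>vs es. is_cycle G vs es) \<longleftrightarrow> (\<exists>e\<in>edges G. mg_connected (delete_edge G e))"
    if "mg_connected G"
    unfolding cycle_iff_redundant_edge[OF assms] using that by blast
  then show ?thesis unfolding is_tree_def by blast
qed

subsection \<open>Contraction\<close>

lemma contract_edge_simps [simp]:
  "verts (contract_edge G e) = merge_ends G e ` verts G"
  "edges (contract_edge G e) = edges G - {e}"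
  "ends (contract_edge G e) f = merge_ends G e ` ends G f"
  by (simp_all add: contract_edge_def)

lemma finite_mgraph_contract_edge:
  assumes "finite_mgraph G"
  shows "finite_mgraph (contract_edge G e)"
proof -
  have "card (merge_ends G e ` ends G f) \<in> {1, 2}" if f: "f \<in> edges G" for f
  proof -
    obtain a b where "ends G f = {a, b}" using ends_doubleton[OF assms f] .
    then show ?thesis by (simp add: card_insert_if)
  qed
  then show ?thesis using assms unfolding finite_mgraph_def by auto
qed

text \<open>A genuine equality, not just an isomorphism: \<open>merge_ends\<close> depends only on
  the ends of \<open>e\<close>, so both sides choose the same representative.\<close>

lemma delete_contract_commute:
  "delete_edge (contract_edge G e) f = contract_edge (delete_edge G f) e"
  unfolding delete_edge_def contract_edge_def merge_ends_def by auto

lemma contract_edge_restrict: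
  assumes "e \<notin> A"
  shows "(contract_edge G e)\<lparr>edges := A\<rparr> = contract_edge (G\<lparr>edges := insert e A\<rparr>) e"
  using assms unfolding contract_edge_def merge_ends_def by auto

lemma merge_ends_reachable:
  assumes "finite_mgraph G" "e \<in> edges G"
  shows "(x, merge_ends G e x) \<in> (adj G)\<^sup>*"
proof (cases "x \<in> ends G e")
  case True
  obtain a b where ab: "ends G e = {a, b}" using ends_doubleton[OF assms] .
  have "merge_ends G e x \<in> ends G e"
    using True unfolding merge_ends_def by (auto intro: someI)
  moreover have "(a, b) \<in> adj G" "(b, a) \<in> adj G"
    using ab assms unfolding adj_def by (auto simp: insert_commute)
  ultimately show ?thesis using True ab by auto
qed (simp add: merge_ends_def)

lemma reachable_contract_edge_iff:
  assumes "finite_mgraph G" "e \<in> edges G"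
  shows "(merge_ends G e x, merge_ends G e y) \<in> (adj (contract_edge G e))\<^sup>* \<longleftrightarrow> (x, y) \<in> (adj G)\<^sup>*"
proof
  assume *: "(merge_ends G e x, merge_ends G e y) \<in> (adj (contract_edge G e))\<^sup>*"
  note reach = merge_ends_reachable[OF assms]
  \<comment> \<open>Merging moves a vertex only along \<open>e\<close>, so a step of the contraction
    can be traced by a walk in \<open>G\<close> between the same representatives.\<close>
  have "adj (contract_edge G e) \<subseteq> (adj G)\<^sup>*"
  proof clarify
    fix p q assume "(p, q) \<in> adj (contract_edge G e)"
    then obtain f where f: "f \<in> edges G" "merge_ends G e ` ends G f = {p, q}"
      unfolding adj_def by auto
    obtain a b where ab: "ends G f = {a, b}" using ends_doubleton[OF assms(1) f(1)] .
    have "(a, b) \<in> (adj G)\<^sup>*" using ab f unfolding adj_def by auto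
    then have "(merge_ends G e a, merge_ends G e b) \<in> (adj G)\<^sup>*"
      using reach[of a] reach[of b] by (meson rtrancl_trans sym_adj_rtrancl)
    then show "(p, q) \<in> (adj G)\<^sup>*"
      using f ab sym_adj_rtrancl by (auto simp: doubleton_eq_iff)
  qed
  then have "(merge_ends G e x, merge_ends G e y) \<in> (adj G)\<^sup>*"
    using * by (metis rtrancl_idemp rtrancl_mono subsetD)
  then show "(x, y) \<in> (adj G)\<^sup>*"
    using reach[of x] reach[of y] by (meson rtrancl_trans sym_adj_rtrancl)
next
  assume "(x, y) \<in> (adj G)\<^sup>*"
  then show "(merge_ends G e x, merge_ends G e y) \<in> (adj (contract_edge G e))\<^sup>*"
  proof (induction rule: rtrancl_induct)
    case (step y z)
    then obtain f where f: "f \<in> edges G" "ends G f = {y, z}" unfolding adj_def by auto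
    show ?case
    proof (cases "f = e")
      case True
      then have "merge_ends G e y = merge_ends G e z" using f unfolding merge_ends_def by auto
      then show ?thesis using step by simp
    next
      case False
      then have "(merge_ends G e y, merge_ends G e z) \<in> adj (contract_edge G e)"
        using f unfolding adj_def by auto
      then show ?thesis using step by (simp add: rtrancl.rtrancl_into_rtrancl)
    qed
  qed simp
qed

lemma mg_connected_contract_edge_iff:
  assumes "finite_mgraph G" "e \<in> edges G"
  shows "mg_connected (contract_edge G e) \<longleftrightarrow> mg_connected G"
  unfolding mg_connected_def using reachable_contract_edge_iff[OF assms] by auto

text \<open>A walk can be shortened so that it crosses the added link between \<open>a\<close> and
  \<open>b\<close> at most once, in one of two directions.\<close>

lemma rtrancl_Un_swap_cases:
  assumes "(x, y) \<in> (R \<union> {(a, b), (b, a)})\<^sup>*"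
  shows "(x, y) \<in> R\<^sup>* \<or> (x, a) \<in> R\<^sup>* \<and> (b, y) \<in> R\<^sup>* \<or> (x, b) \<in> R\<^sup>* \<and> (a, y) \<in> R\<^sup>*"
  using assms by (induction rule: rtrancl_induct) (auto intro: rtrancl_into_rtrancl)

text \<open>Any edge \<open>f\<close> of a minimal set of edges connecting the ends of \<open>e\<close> will do.\<close>

lemma exchange_connecting_edge:
  assumes fin: "finite_mgraph G" and e: "ends G e = {u, v}" "u \<noteq> v" "e \<in> edges G"
    and con: "mg_connected (delete_edge G e)"
  shows "\<exists>f\<in>edges G - {e}. mg_connected (delete_edge G f)"
proof -
  define C where "C = (\<lambda>A. A \<subseteq> edges G - {e} \<and> (u, v) \<in> (adj (G\<lparr>edges := A\<rparr>))\<^sup>*)"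
  have cG: "mg_connected G" using mg_connected_mono[OF con] by auto
  have finE: "finite (edges G)" using fin unfolding finite_mgraph_def by blast
  have "(u, v) \<in> (adj (delete_edge G e))\<^sup>*"
    using mg_connected_delete_edge_iff[OF fin cG e(3,1)] con by blast
  then have "C (edges G - {e})" unfolding C_def delete_edge_def by auto
  then obtain P where P: "C P" "\<And>Q. C Q \<Longrightarrow> card P \<le> card Q"
    using ex_has_least_nat[of C _ card] by blast
  have "P \<noteq> {}"
  proof
    assume "P = {}"
    then have "adj (G\<lparr>edges := P\<rparr>) = {}" by (simp add: adj_def)
    then show False using P(1) e(2) unfolding C_def by auto
  qed
  then obtain f where f: "f \<in> P" by blast
  then have fE: "f \<in> edges G" "f \<noteq> e" using P(1) unfolding C_def by auto
  obtain a b where ab: "ends G f = {a, b}" using ends_doubleton[OF fin fE(1)] .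
  let ?R = "adj (G\<lparr>edges := P - {f}\<rparr>)" and ?D = "adj (delete_edge G f)"
  have "finite P" using P(1) finE unfolding C_def by (auto intro: finite_subset)
  \<comment> \<open>By minimality, every connection from \<open>u\<close> to \<open>v\<close> inside
    \<open>P\<close> crosses \<open>f\<close>, so it splits into two pieces avoiding
    \<open>f\<close>.\<close>
  then have "\<not> C (P - {f})" using P(2)[of "P - {f}"] f card_Diff1_less[of P f] by auto
  then have nR: "(u, v) \<notin> ?R\<^sup>*" using P(1) unfolding C_def by auto
  have "(u, v) \<in> (?R \<union> {(a, b), (b, a)})\<^sup>*"
    using P(1) f adj_edges_insert[of G f a b "P - {f}"] ab unfolding C_def
    by (simp add: insert_absorb)
  from rtrancl_Un_swap_cases[OF this] nR
  have split: "(u, a) \<in> ?R\<^sup>* \<and> (b, v) \<in> ?R\<^sup>* \<or> (u, b) \<in> ?R\<^sup>* \<and> (a, v) \<in> ?R\<^sup>*"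
    by simp
  have "?R\<^sup>* \<subseteq> ?D\<^sup>*"
    using P(1) unfolding C_def by (intro rtrancl_mono adj_mono) auto
  with split have "(u, a) \<in> ?D\<^sup>* \<and> (b, v) \<in> ?D\<^sup>* \<or> (u, b) \<in> ?D\<^sup>* \<and> (a, v) \<in> ?D\<^sup>*"
    by blast
  \<comment> \<open>The edge \<open>e\<close> survives the deletion of \<open>f\<close> and joins
    the two pieces into a detour from \<open>a\<close> to \<open>b\<close>.\<close>
  moreover have "(u, v) \<in> ?D\<^sup>*" using e fE unfolding adj_def by auto
  ultimately have "(a, b) \<in> ?D\<^sup>*"
    by (meson rtrancl_trans sym_adj_rtrancl)
  then show ?thesis
    using mg_connected_delete_edge_iff[OF fin cG fE(1) ab] fE by blast
qed

text \<open>Edges other than \<open>e\<close> are redundant in \<open>G / e\<close> exactly when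
  they are in \<open>G\<close>. The contraction says nothing about \<open>e\<close> itself, but
  \<open>exchange_connecting_edge\<close> shows that a redundant non-loop \<open>e\<close> comes
  with another redundant edge.\<close>

lemma is_tree_contract_edge_iff:
  assumes fin: "finite_mgraph G" and e: "e \<in> edges G" "\<not> is_loop G e"
  shows "is_tree (contract_edge G e) \<longleftrightarrow> is_tree G"
proof -
  obtain u v where uv: "ends G e = {u, v}" using ends_doubleton[OF fin e(1)] .
  then have "u \<noteq> v" using e unfolding is_loop_def by auto
  have "mg_connected (delete_edge (contract_edge G e) f) \<longleftrightarrow> mg_connected (delete_edge G f)"
    if "f \<in> edges G - {e}" for f
    unfolding delete_contract_commute
    using that e by (intro mg_connected_contract_edge_iff finite_mgraph_delete_edge fin) auto
  then show ?thesis
    unfolding is_tree_iff_minimal_connected[OF fin]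
      is_tree_iff_minimal_connected[OF finite_mgraph_contract_edge[OF fin]]
      mg_connected_contract_edge_iff[OF fin e(1)]
    using exchange_connecting_edge[OF fin uv \<open>u \<noteq> v\<close> e(1)] by auto
qed

text \<open>The previous lemma is applied to the subgraph \<open>T\<close> instead of
  \<open>G\<close>, since contraction commutes with restriction to a set containing
  \<open>e\<close>.\<close>

lemma spanning_tree_contract_edge_iff:
  assumes "finite_mgraph G" "e \<in> edges G" "\<not> is_loop G e" "e \<in> T"
  shows "spanning_tree (contract_edge G e) (T - {e}) \<longleftrightarrow> spanning_tree G T"
proof (cases "T \<subseteq> edges G")
  case True
  have "is_tree (contract_edge (G\<lparr>edges := T\<rparr>) e) \<longleftrightarrow> is_tree (G\<lparr>edges := T\<rparr>)"
    using assms True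
    by (intro is_tree_contract_edge_iff finite_mgraph_edges_subset) (auto simp: is_loop_def)
  then show ?thesis
    using True assms contract_edge_restrict[of e "T - {e}" G]
    unfolding spanning_tree_def by (auto simp: insert_absorb)
qed (use assms in \<open>auto simp: spanning_tree_def\<close>)

lemma spanning_tree_delete_edge_iff:
  "spanning_tree (delete_edge G e) T \<longleftrightarrow> e \<notin> T \<and> spanning_tree G T"
  unfolding spanning_tree_def delete_edge_def by auto

lemma spanning_tree_subset: "spanning_tree G T \<Longrightarrow> T \<subseteq> edges G"
  by (simp add: spanning_tree_def)

subsection \<open>Loops and isthmuses\<close>

lemma card_components_eq_1_iff:
  assumes "verts G \<noteq> {}"
  shows "card (components G) = 1 \<longleftrightarrow> mg_connected G"
proof -
  let ?E = "(adj G)\<^sup>* \<inter> verts G \<times> verts G"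
  have E: "equiv (verts G) ?E"
  proof (rule equivI)
    show "trans ?E" unfolding trans_def by (blast intro: rtrancl_trans)
  qed (auto simp: refl_on_def sym_def sym_adj_rtrancl)
  obtain x where x: "x \<in> verts G" using assms by blast
  show ?thesis
  proof
    assume "card (components G) = 1"
    then obtain c where c: "verts G // ?E = {c}"
      unfolding components_def by (auto simp: card_1_singleton_iff)
    have "?E `` {y} = c" if "y \<in> verts G" for y
      using quotientI[OF that, of ?E] c by auto
    then have "(y, z) \<in> (adj G)\<^sup>*" if "y \<in> verts G" "z \<in> verts G" for y z
      using eq_equiv_class[OF _ E that(2), of y] that by blast
    then show "mg_connected G" using assms unfolding mg_connected_def by blast
  next
    assume "mg_connected G"
    then have "?E = verts G \<times> verts G" unfolding mg_connected_def by auto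
    then have "components G = {verts G}"
      using x unfolding components_def quotient_def by auto
    then show "card (components G) = 1" by simp
  qed
qed

lemma card_components_pos:
  assumes "finite_mgraph G" "verts G \<noteq> {}"
  shows "card (components G) > 0"
proof -
  have "finite (components G)" "components G \<noteq> {}"
    using assms unfolding components_def finite_mgraph_def quotient_def by simp_all
  then show ?thesis by (simp add: card_gt_0_iff)
qed

text \<open>The connected graph has one component and the deletion has at least one, so the number
  grows exactly when it is no longer 1.\<close>

lemma isthmus_iff:
  assumes "finite_mgraph G" "mg_connected G" "e \<in> edges G"
  shows "isthmus G e \<longleftrightarrow> \<not> mg_connected (delete_edge G e)"
proof -
  have V: "verts G \<noteq> {}" using assms unfolding mg_connected_def by blast
  then have "card (components G) = 1" using card_components_eq_1_iff[of G] assms(2) by simp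
  moreover have "card (components (delete_edge G e)) > 0"
    using card_components_pos[OF finite_mgraph_delete_edge[OF assms(1)]] V by simp
  moreover have "card (components (delete_edge G e)) = 1 \<longleftrightarrow> mg_connected (delete_edge G e)"
    by (rule card_components_eq_1_iff) (use V in simp)
  ultimately show ?thesis using assms(3) unfolding isthmus_def by linarith
qed

lemma mg_connected_delete_loop:
  assumes "finite_mgraph G" "mg_connected G" "is_loop G e"
  shows "mg_connected (delete_edge G e)"
proof -
  obtain v where v: "e \<in> edges G" "ends G e = {v, v}" using assms(3) unfolding is_loop_def by auto
  show ?thesis using mg_connected_delete_edge_iff[OF assms(1,2) v] by simp
qed

lemma loop_notin_spanning_tree:
  assumes "finite_mgraph G" "is_loop G e" "spanning_tree G T"
  shows "e \<notin> T"
proof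
  assume "e \<in> T"
  obtain v where v: "ends G e = {v}" "v \<in> verts G"
    using assms(1,2) unfolding is_loop_def finite_mgraph_def by auto
  \<comment> \<open>A loop is a cycle of length 1: the successor index \<open>Suc 0 mod 1\<close> is
    again 0.\<close>
  then have "is_cycle (G\<lparr>edges := T\<rparr>) [v] [e]"
    using \<open>e \<in> T\<close> unfolding is_cycle_def by auto
  then show False using assms(3) unfolding spanning_tree_def is_tree_def by blast
qed

text \<open>A spanning tree avoiding \<open>e\<close> would keep \<open>G\<close> connected after
  the deletion of \<open>e\<close>.\<close>

lemma isthmus_in_spanning_tree:
  assumes "finite_mgraph G" "mg_connected G" "isthmus G e" "spanning_tree G T"
  shows "e \<in> T"
proof (rule ccontr)
  assume "e \<notin> T"
  have "mg_connected (G\<lparr>edges := T\<rparr>)" "T \<subseteq> edges G"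
    using assms(4) unfolding spanning_tree_def is_tree_def by auto
  then have "mg_connected (delete_edge G e)"
    using \<open>e \<notin> T\<close> mg_connected_mono[of "G\<lparr>edges := T\<rparr>" "delete_edge G e"] by auto
  moreover have "e \<in> edges G" using assms(3) unfolding isthmus_def by blast
  ultimately show False using isthmus_iff[OF assms(1,2)] assms(3) by simp
qed

subsection \<open>The partition into intervals\<close>

lemma branches_nonempty: "branches t \<noteq> {}"
  by (induction t) auto

lemma set_tree_branches: "set_tree t = (\<Union>p\<in>branches t. set p)"
proof (induction t)
  case (Node l e r)
  then show ?case using branches_nonempty[of l] by auto
qed simp

text \<open>A run consults \<open>S\<close> only at labels it meets. This allows the root edge to be
  dropped from the set when passing to a subtree.\<close>

lemma run_cong:
  fixes H :: "('v, 'e) mgraph"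
  shows "S \<inter> set_tree t = S' \<inter> set_tree t \<Longrightarrow> run H t S = run H t S'"
proof (induction t arbitrary: H)
  case (Node l e r)
  have "S \<inter> set_tree l = S' \<inter> set_tree l" "S \<inter> set_tree r = S' \<inter> set_tree r"
    using Node.prems by auto
  from Node.IH(1)[OF this(1)] Node.IH(2)[OF this(2)]
  have "run K l S = run K l S'" "run K r S = run K r S'" for K :: "('v, 'e) mgraph"
    by -
  moreover have "e \<in> S \<longleftrightarrow> e \<in> S'" using Node.prems by auto
  ultimately show ?case by simp
qed simp

lemma active_cong: "S \<inter> set_tree t = S' \<inter> set_tree t \<Longrightarrow> active H t S = active H t S'"
  unfolding active_def by (drule run_cong[where H = H]) simp

lemma fst_run_subset:
  fixes H :: "('v, 'e) mgraph"
  shows "fst ` set (run H t S) \<subseteq> set_tree t"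
proof (induction t arbitrary: H)
  case (Node l e r)
  have "fst ` set (run K l S) \<subseteq> set_tree l" "fst ` set (run K r S) \<subseteq> set_tree r"
    for K :: "('v, 'e) mgraph"
    using Node.IH .
  from this[of "delete_edge H e"] this[of "contract_edge H e"]
  show ?case by (simp add: subset_insertI2 le_supI1 le_supI2)
qed simp

lemma active_subset: "active H t S \<subseteq> set_tree t"
proof
  fix x assume "x \<in> active H t S"
  then obtain p where "p \<in> set (run H t S)" "fst p = x"
    unfolding active_def by force
  then show "x \<in> set_tree t" using fst_run_subset[of H t S] by auto
qed

text \<open>The loop test may come first because a standard edge is never a loop.\<close>

lemma active_Node:
  "active H (Node l e r) S =
     (if is_loop H e then insert e (active (delete_edge H e) l S)
      else if standard H e then
        if e \<in> S then active (contract_edge H e) r S else active (delete_edge H e) l S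
      else insert e (active (contract_edge H e) r S))"
  unfolding active_def by (auto simp: standard_def)

text \<open>The branch condition of \<open>decision_tree\<close>, with the edge set as a parameter
  so that it is inherited by both subtrees once the root label is removed.\<close>

definition labelled_by :: "'e tree \<Rightarrow> 'e set \<Rightarrow> bool" where
  "labelled_by t E \<longleftrightarrow> (\<forall>p\<in>branches t. distinct p \<and> set p = E)"

lemma labelled_by_set_tree: "labelled_by t E \<Longrightarrow> set_tree t = E"
  using branches_nonempty[of t] unfolding labelled_by_def set_tree_branches by auto

lemma labelled_by_Leaf: "labelled_by Leaf E \<longleftrightarrow> E = {}"
  unfolding labelled_by_def by auto

lemma labelled_by_NodeD:
  assumes "labelled_by (Node l e r) E"
  shows "e \<in> E" "labelled_by l (E - {e})" "labelled_by r (E - {e})"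
  using assms labelled_by_set_tree[OF assms] unfolding labelled_by_def by auto

section \<open>Intervals under deletion and contraction\<close>

definition in_interval :: "('v, 'e) mgraph \<Rightarrow> 'e tree \<Rightarrow> 'e set \<Rightarrow> 'e set \<Rightarrow> bool" where
  "in_interval G \<Delta> S T \<longleftrightarrow>
     spanning_tree G T \<and> T - int_active G \<Delta> T \<subseteq> S \<and> S \<subseteq> T \<union> ext_active G \<Delta> T"

text \<open>Removal from \<open>T\<close> only affects active edges in \<open>T\<close>, and union
  with \<open>T\<close> only gains from those outside, so both bounds can use the same set.\<close>

lemma in_interval_alt:
  "in_interval G \<Delta> S T \<longleftrightarrow>
     spanning_tree G T \<and> T - active G \<Delta> T \<subseteq> S \<and> S \<subseteq> T \<union> active G \<Delta> T"
  unfolding in_interval_def int_active_def ext_active_def by auto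

text \<open>No \<open>T\<close> on the left contains \<open>e\<close>: a loop lies in no spanning
  tree, and a standard \<open>e\<close> in \<open>T\<close> is inactive, which would force it into
  \<open>S\<close>. For the remaining \<open>T\<close> the run continues in \<open>l\<close>; if
  \<open>e\<close> is in \<open>S\<close> it is a loop, hence active, so removing it from
  \<open>S\<close> changes nothing.\<close>

lemma in_interval_delete_edge:
  assumes fin: "finite_mgraph G"
    and lab: "labelled_by (Node l e r) (edges G)"
    and e: "is_loop G e \<or> standard G e \<and> e \<notin> S"
  shows "in_interval G (Node l e r) S T \<longleftrightarrow> in_interval (delete_edge G e) l (S - {e}) T"
proof -
  note sub = active_subset[of "delete_edge G e" l T, unfolded
      labelled_by_set_tree[OF labelled_by_NodeD(2)[OF lab]]]
  have sub': "e \<notin> active (contract_edge G e) r T"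
    using active_subset[of "contract_edge G e" r T]
      labelled_by_set_tree[OF labelled_by_NodeD(3)[OF lab]] by auto
  show ?thesis
  proof (cases "e \<in> T")
    case True
    then have "\<not> in_interval (delete_edge G e) l (S - {e}) T"
      by (simp add: in_interval_alt spanning_tree_delete_edge_iff)
    moreover have "\<not> in_interval G (Node l e r) S T"
      using e True sub' loop_notin_spanning_tree[OF fin]
      by (auto simp: in_interval_alt active_Node standard_def)
    ultimately show ?thesis by blast
  next
    case False
    then show ?thesis using e sub
      by (auto simp: in_interval_alt active_Node spanning_tree_delete_edge_iff standard_def)
  qed
qed

text \<open>Dually, every \<open>T\<close> on the left contains \<open>e\<close>: an isthmus lies in
  all spanning trees, and a standard \<open>e\<close> outside \<open>T\<close> is inactive, hence
  would be outside \<open>S\<close>.\<close>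

lemma in_interval_contract_edge:
  assumes fin: "finite_mgraph G" and con: "mg_connected G"
    and lab: "labelled_by (Node l e r) (edges G)"
    and e: "\<not> is_loop G e" "standard G e \<Longrightarrow> e \<in> S"
  shows "in_interval G (Node l e r) S T \<longleftrightarrow>
    e \<in> T \<and> in_interval (contract_edge G e) r (S - {e}) (T - {e})"
proof -
  have eE: "e \<in> edges G" using labelled_by_NodeD(1)[OF lab] .
  have set_r: "set_tree r = edges G - {e}"
    using labelled_by_set_tree[OF labelled_by_NodeD(3)[OF lab]] .
  \<comment> \<open>The label \<open>e\<close> does not recur in \<open>r\<close>, so
    \<open>T\<close> and its contraction have the same active edges there.\<close>
  have act: "active (contract_edge G e) r T = active (contract_edge G e) r (T - {e})"
    by (rule active_cong) (auto simp: set_r)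
  have sub: "e \<notin> active (contract_edge G e) r (T - {e})"
    using active_subset[of "contract_edge G e" r "T - {e}"] set_r by auto
  have sub': "e \<notin> active (delete_edge G e) l T"
    using active_subset[of "delete_edge G e" l T]
      labelled_by_set_tree[OF labelled_by_NodeD(2)[OF lab]] by auto
  show ?thesis
  proof (cases "e \<in> T")
    case True
    show ?thesis
    proof (cases "standard G e")
      case std: True
      then show ?thesis
        using True e act sub spanning_tree_contract_edge_iff[OF fin eE e(1) True]
        by (auto simp: in_interval_alt active_Node)
    next
      case False
      then show ?thesis
        using True e act sub spanning_tree_contract_edge_iff[OF fin eE e(1) True]
        by (auto simp: in_interval_alt active_Node)
    qed
  next
    case False
    have "\<not> in_interval G (Node l e r) S T"
    proof (cases "standard G e")
      case True
      then show ?thesis using e False sub' by (auto simp: in_interval_alt active_Node)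
    next
      case nonstandard: False
      then have "isthmus G e" using e eE unfolding standard_def by blast
      then show ?thesis
        using False isthmus_in_spanning_tree[OF fin con] by (auto simp: in_interval_alt)
    qed
    then show ?thesis using False by blast
  qed
qed

lemma spanning_tree_no_edges:
  assumes "finite_mgraph G" "mg_connected G" "edges G = {}"
  shows "spanning_tree G T \<longleftrightarrow> T = {}"
proof -
  have eq: "G\<lparr>edges := {}\<rparr> = G" using assms(3) by (cases G) simp
  have "is_tree (G\<lparr>edges := {}\<rparr>)"
    unfolding eq using is_tree_iff_minimal_connected[OF assms(1)] assms by simp
  then show ?thesis unfolding spanning_tree_def using assms(3) by auto
qed

text \<open>Existence of \<open>T\<close> gives the covering and uniqueness the disjointness.
  \<open>G\<close> and \<open>S\<close> vary in the induction, which passes to a minor and to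
  \<open>S - {e}\<close>; it starts from the edgeless graph, whose only subgraph is its
  tree.\<close>

lemma ex1_in_interval:
  assumes "finite_mgraph G" "mg_connected G" "labelled_by \<Delta> (edges G)" "S \<subseteq> edges G"
  shows "\<exists>!T. in_interval G \<Delta> S T"
  using assms
proof (induction \<Delta> arbitrary: G S)
  case Leaf
  then have "edges G = {}" "S = {}" by (auto simp: labelled_by_Leaf)
  then show ?case
    using Leaf.prems spanning_tree_no_edges[of G]
    by (auto simp: in_interval_alt active_def)
next
  case (Node l e r)
  note lab = labelled_by_NodeD[OF Node.prems(3)]
  show ?case
  proof (cases "is_loop G e \<or> standard G e \<and> e \<notin> S")
    case True
    have "mg_connected (delete_edge G e)"
      using True mg_connected_delete_loop[OF Node.prems(1,2)]
        isthmus_iff[OF Node.prems(1,2) lab(1)] unfolding standard_def by blast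
    then have "\<exists>!T. in_interval (delete_edge G e) l (S - {e}) T"
      using Node.prems lab by (intro Node.IH(1) finite_mgraph_delete_edge) auto
    then show ?thesis using in_interval_delete_edge[OF Node.prems(1,3) True] by simp
  next
    case False
    have "mg_connected (contract_edge G e)"
      using mg_connected_contract_edge_iff[OF Node.prems(1) lab(1)] Node.prems(2) by blast
    then have "\<exists>!T. in_interval (contract_edge G e) r (S - {e}) T"
      using Node.prems lab by (intro Node.IH(2) finite_mgraph_contract_edge) auto
    then obtain T where T: "in_interval (contract_edge G e) r (S - {e}) T"
      "\<And>T'. in_interval (contract_edge G e) r (S - {e}) T' \<Longrightarrow> T' = T" by blast
    \<comment> \<open>\<open>T\<close> consists of edges of the contraction; hence removing
      \<open>e\<close> from the witness \<open>insert e T\<close> below gives back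
      \<open>T\<close>.\<close>
    have "e \<notin> T"
      using T(1) spanning_tree_subset by (fastforce simp: in_interval_def)
    have iff: "in_interval G (Node l e r) S T' \<longleftrightarrow>
        e \<in> T' \<and> in_interval (contract_edge G e) r (S - {e}) (T' - {e})" for T'
      using False by (intro in_interval_contract_edge Node.prems) auto
    show ?thesis
    proof
      show "in_interval G (Node l e r) S (insert e T)"
        using T(1) \<open>e \<notin> T\<close> unfolding iff by simp
      show "T' = insert e T" if "in_interval G (Node l e r) S T'" for T'
        using that T(2)[of "T' - {e}"] unfolding iff by blast
    qed
  qed
qed

theorem theorem6p3:
  fixes G :: "('v, 'e) mgraph" and \<Delta> :: "'e tree"
  assumes "finite_mgraph G" and "mg_connected G" and "edges G \<noteq> {}"
    and "decision_tree G \<Delta>"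
  shows "Pow (edges G) =
           (\<Union>T\<in>{T. spanning_tree G T}.
              {S. T - int_active G \<Delta> T \<subseteq> S \<and> S \<subseteq> T \<union> ext_active G \<Delta> T})
       \<and> disjoint_family_on
           (\<lambda>T. {S. T - int_active G \<Delta> T \<subseteq> S \<and> S \<subseteq> T \<union> ext_active G \<Delta> T})
           {T. spanning_tree G T}"
proof -
  have lab: "labelled_by \<Delta> (edges G)"
    using assms(4) unfolding decision_tree_def labelled_by_def by simp
  note ex1 = ex1_in_interval[OF assms(1,2) lab]
  \<comment> \<open>Active edges are labels of the decision tree, so intervals contain only
    subgraphs of \<open>G\<close>.\<close>
  have sub: "S \<subseteq> edges G" if S: "in_interval G \<Delta> S T" for S T
  proof -
    have "S \<subseteq> T \<union> active G \<Delta> T" "T \<subseteq> edges G"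
      using S spanning_tree_subset[of G T] unfolding in_interval_alt by simp_all
    then show ?thesis
      using active_subset[of G \<Delta> T] unfolding labelled_by_set_tree[OF lab] by auto
  qed
  have "Pow (edges G) = {S. \<exists>T. in_interval G \<Delta> S T}"
  proof (intro set_eqI iffI)
    fix S assume "S \<in> Pow (edges G)"
    then show "S \<in> {S. \<exists>T. in_interval G \<Delta> S T}"
      using ex1_implies_ex[OF ex1, of S] by simp
  next
    fix S assume "S \<in> {S. \<exists>T. in_interval G \<Delta> S T}"
    then obtain T where "in_interval G \<Delta> S T" by blast
    then show "S \<in> Pow (edges G)" by (simp add: sub)
  qed
  also have "\<dots> = (\<Union>T\<in>{T. spanning_tree G T}.
      {S. T - int_active G \<Delta> T \<subseteq> S \<and> S \<subseteq> T \<union> ext_active G \<Delta> T})"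
    unfolding in_interval_def by auto
  finally have cover: "Pow (edges G) = \<dots>" .
  show ?thesis
    unfolding disjoint_family_on_def
  proof (intro conjI cover ballI impI)
    fix T T' assume T: "T \<in> {T. spanning_tree G T}" "T' \<in> {T. spanning_tree G T}" "T \<noteq> T'"
    \<comment> \<open>A common member \<open>S\<close> of two intervals would have two trees,
      against uniqueness.\<close>
    have "T = T'" if "in_interval G \<Delta> S T" "in_interval G \<Delta> S T'" for S
      by (rule ex1E[OF ex1[OF sub[OF that(1)]]]) (use that in metis)
    then show "{S. T - int_active G \<Delta> T \<subseteq> S \<and> S \<subseteq> T \<union> ext_active G \<Delta> T} \<inter>
        {S. T' - int_active G \<Delta> T' \<subseteq> S \<and> S \<subseteq> T' \<union> ext_active G \<Delta> T'} = {}"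
      using T unfolding in_interval_def by blast
  qed
qed

end
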